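(* Let $\mathbf{w} = (w_1, w_2, \ldots)$ be a sequence of words in $A^+$ (with $A=\{a,b\}$) such that for every $n\in\mathbb{N}$ there are no $s, t, v \in A^*$ with $w_n = stv$ and $st, tv \in S_{\mathbf{w}}$. For each $n$, let $p_n$ and $s_n$ be respectively the longest prefix and the longest suffix of $w_n$ belonging to $S_{\mathbf{w}}$, and let $u_n\in A^*$ be such that $w_n = p_n u_n s_n$. Suppose that for all $n,m\in\mathbb{N}$, $u_n$ is a subword of $w_m$ if and only if $n = m$, and that $u_n$ is not a subword of $p_n$ for all $n$. Then $(w_1, w_2, \ldots)$ is a universal sequence for $X^X$ for every infinite set $X$.
   Context: $A = \{a,b\}$; $A^*$ is the free monoid on $A$ with empty word $\varepsilon$ (a prefix and suffix of every word), and $A^+ = A^*\setminus\{\varepsilon\}$. For a sequence $\mathbf{w}=(w_1,w_2,\ldots)$ in $A^+$, $S_{\mathbf{w}}$ is the least submonoid $S$ of $A^*$ satisfying: (C1) if $w_n = s v u v s'$ for some $n$, with $s, s' \in S$ and $u, v \in A^*$, then $v \in S$; (C2) if $w_m = s v t$ and $w_n = t' v s'$ for some $m \neq n$, with $s, s' \in S$ and $t, t', v \in A^*$, then $v \in S$. $X^X$ is the full transformation monoid of all functions $X\to X$ under composition. A sequence $w_1, w_2, \ldots \in A^+$ is universal for a semigroup $T$ if for every sequence $f_1, f_2, \ldots \in T$ there is a semigroup homomorphism $\Phi: A^+ \to T$ with $(w_n)\Phi = f_n$ for all $n$. *)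

theory Defs
  imports Main
begin

datatype letter = a | b

type_synonym word = "letter list"

definition submonoid :: "word set \<Rightarrow> bool" where
  "submonoid S \<longleftrightarrow> [] \<in> S \<and> (\<forall>x\<in>S. \<forall>y\<in>S. x @ y \<in> S)"

definition cond_C1 :: "(nat \<Rightarrow> word) \<Rightarrow> word set \<Rightarrow> bool" where
  "cond_C1 w S \<longleftrightarrow> (\<forall>n s s' u v. w n = s @ v @ u @ v @ s' \<and> s \<in> S \<and> s' \<in> S \<longrightarrow> v \<in> S)"

definition cond_C2 :: "(nat \<Rightarrow> word) \<Rightarrow> word set \<Rightarrow> bool" where
  "cond_C2 w S \<longleftrightarrow> (\<forall>m n s s' t t' v. m \<noteq> n \<and> w m = s @ v @ t \<and> w n = t' @ v @ s'
        \<and> s \<in> S \<and> s' \<in> S \<longrightarrow> v \<in> S)"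

definition S_w :: "(nat \<Rightarrow> word) \<Rightarrow> word set" where
  "S_w w = \<Inter> {S. submonoid S \<and> cond_C1 w S \<and> cond_C2 w S}"

definition subword :: "word \<Rightarrow> word \<Rightarrow> bool" where
  "subword u x \<longleftrightarrow> (\<exists>y z. x = y @ u @ z)"

definition is_longest_prefix_in :: "word set \<Rightarrow> word \<Rightarrow> word \<Rightarrow> bool" where
  "is_longest_prefix_in S x p \<longleftrightarrow> (\<exists>r. x = p @ r) \<and> p \<in> S \<and>
     (\<forall>q r. x = q @ r \<and> q \<in> S \<longrightarrow> length q \<le> length p)"

definition is_longest_suffix_in :: "word set \<Rightarrow> word \<Rightarrow> word \<Rightarrow> bool" where
  "is_longest_suffix_in S x s \<longleftrightarrow> (\<exists>r. x = r @ s) \<and> s \<in> S \<and>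
     (\<forall>q r. x = r @ q \<and> q \<in> S \<longrightarrow> length q \<le> length s)"

text \<open>Universality for the full transformation monoid on the (infinite) type 'x.
  Maps are written on the right as in the paper, so the product fg in X^X is
  "first f, then g", i.e. g \<circ> f; a semigroup homomorphism \<Phi> : A^+ \<rightarrow> X^X
  therefore satisfies \<Phi>(uv) = \<Phi> v \<circ> \<Phi> u for nonempty u, v.\<close>
definition universal_for_transf :: "(nat \<Rightarrow> word) \<Rightarrow> 'x itself \<Rightarrow> bool" where
  "universal_for_transf w TYPE('x) \<longleftrightarrow>
     (\<forall>f :: nat \<Rightarrow> 'x \<Rightarrow> 'x. \<exists>\<Phi> :: word \<Rightarrow> 'x \<Rightarrow> 'x.
        (\<forall>u v. u \<noteq> [] \<longrightarrow> v \<noteq> [] \<longrightarrow> \<Phi> (u @ v) = \<Phi> v \<circ> \<Phi> u) \<and>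
        (\<forall>n. \<Phi> (w n) = f n))"

end

theory Submission
  imports Defs "HOL-Library.Countable"
begin

text \<open>
  Let \<open>S = S_w w\<close>. The closure conditions force the atoms of \<open>S\<close> (the nonempty elements that
  are not products of two nonempty elements of \<open>S\<close>) to form a code \<open>B\<close> without overlaps, while
  maximality of \<open>p n\<close> and \<open>s n\<close> prevents the words \<open>u n\<close> from overlapping each other
  or any atom.

  The state space is \<open>X \<times> M\<close>, where \<open>M\<close> is the monoid obtained from \<open>A\<^sup>*\<close> by formally
  inverting \<open>B\<close>. Because \<open>B\<close> is overlap-free, cancelling an atom against an adjacent inverse
  gives normal forms for \<open>M\<close>. A letter acts by right multiplication, except that completing
  a literal occurrence of \<open>u n\<close> at \<open>(x, h \<cdot> u n)\<close> moves to the image of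
  \<open>(x, h \<cdot> (p n)\<^sup>-\<^sup>1)\<close> under \<open>f n\<close>, multiplied by \<open>(s n)\<^sup>-\<^sup>1\<close>. Reading an
  element of \<open>S\<close> never completes a \<open>u n\<close>, so it is plain multiplication by a unit of \<open>M\<close>;
  hence \<open>p n\<close> and \<open>s n\<close> undo the two corrections and \<open>w n\<close> acts as \<open>f n\<close>. Since \<open>M\<close> is
  countable, \<open>X \<times> M\<close> has the cardinality of \<open>X\<close>.
\<close>

section \<open>Overlap-free codes and reduced words\<close>

locale overlap_free_code =
  fixes B :: "'a list set"
  assumes code_nonempty: "v \<in> B \<Longrightarrow> v \<noteq> []"
    and overlap_free: "\<lbrakk>y @ z \<in> B; x @ y \<in> B; y \<noteq> []\<rbrakk> \<Longrightarrow> x = [] \<and> z = []"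
begin

text \<open>\<open>Inl c\<close> is a letter and \<open>Inr v\<close> is the formal inverse of the code word \<open>v\<close>.\<close>

definition ends_bar_code :: "('a + 'a list) list \<Rightarrow> bool" where
  "ends_bar_code k \<longleftrightarrow> (\<exists>m v. v \<in> B \<and> k = m @ Inr v # map Inl v)"

definition ends_code_bar :: "('a + 'a list) list \<Rightarrow> bool" where
  "ends_code_bar k \<longleftrightarrow> (\<exists>m v. v \<in> B \<and> k = m @ map Inl v @ [Inr v])"

text \<open>Forbidding both endings on every prefix forbids \<open>v\<close> next to its own formal
  inverse anywhere; the prefix form suits words that grow at the right end.\<close>

definition reduced :: "('a + 'a list) list \<Rightarrow> bool" where
  "reduced m \<longleftrightarrow> (\<forall>k l. m = k @ l \<longrightarrow> \<not> ends_bar_code k \<and> \<not> ends_code_bar k)"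

definition code_mult :: "'a list \<Rightarrow> ('a + 'a list) list \<Rightarrow> ('a + 'a list) list" where
  "code_mult v m = (if m \<noteq> [] \<and> last m = Inr v then butlast m else m @ map Inl v)"

definition code_divide :: "'a list \<Rightarrow> ('a + 'a list) list \<Rightarrow> ('a + 'a list) list" where
  "code_divide v m = (if \<exists>k. m = k @ map Inl v then take (length m - length v) m else m @ [Inr v])"

text \<open>A bar \<open>Inr v\<close> never equals a letter, so the last bar fixes the splitting.
  This makes the \<open>THE\<close> in \<open>step\<close> well defined.\<close>

lemma last_bar_unique:
  assumes "x @ Inr v # map Inl y = x' @ Inr v' # map Inl y'"
  shows "x = x' \<and> v = v' \<and> y = y'"
  using assms
proof (induction y arbitrary: y' rule: rev_induct)
  case Nil
  then show ?case by (cases y' rule: rev_cases) auto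
next
  case (snoc c y)
  then show ?case by (cases y' rule: rev_cases) auto
qed

text \<open>The letters \<open>y\<close> contain no bar, so they form a tail of the cancelled code
  word, and \<open>m\<close> must supply the bar and the remaining head \<open>x\<close>.\<close>

lemma ends_bar_code_append:
  assumes "ends_bar_code (m @ map Inl y)"
  obtains x m' where "x @ y \<in> B" "m = m' @ Inr (x @ y) # map Inl x"
proof -
  obtain m' v where v: "v \<in> B" "m @ map Inl y = m' @ Inr v # map Inl v"
    using assms by (auto simp: ends_bar_code_def)
  have "\<exists>x. v = x @ y \<and> m = m' @ Inr v # map Inl x"
    if "m @ map Inl y = m' @ Inr v # map Inl z" "z = v" for z
  proof -
    have "\<exists>x. z = x @ y \<and> m = m' @ Inr v # map Inl x"
      using that(1)
    proof (induction y arbitrary: z rule: rev_induct)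
      case Nil
      then show ?case by auto
    next
      case (snoc c y)
      then show ?case by (cases z rule: rev_cases) auto
    qed
    then show ?thesis using that(2) by auto
  qed
  then show thesis using v that by blast
qed

lemma reduced_Nil [simp]: "reduced []"
  by (auto simp: reduced_def ends_bar_code_def ends_code_bar_def)

lemma reduced_appendD: "reduced (k @ l) \<Longrightarrow> reduced k"
  by (auto simp: reduced_def)

lemma reduced_snoc:
  "reduced m \<Longrightarrow> \<not> ends_bar_code (m @ [z]) \<Longrightarrow> \<not> ends_code_bar (m @ [z]) \<Longrightarrow> reduced (m @ [z])"
  unfolding reduced_def
proof (intro allI impI)
  fix k l
  assume *: "\<forall>k l. m = k @ l \<longrightarrow> \<not> ends_bar_code k \<and> \<not> ends_code_bar k"
    "\<not> ends_bar_code (m @ [z])" "\<not> ends_code_bar (m @ [z])" "m @ [z] = k @ l"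
  then show "\<not> ends_bar_code k \<and> \<not> ends_code_bar k"
    by (cases l rule: rev_cases) auto
qed

lemma reduced_snoc_letter:
  assumes "reduced m" "\<not> ends_bar_code (m @ [Inl c])"
  shows "reduced (m @ [Inl c])"
  using assms by (intro reduced_snoc) (auto simp: ends_code_bar_def)

lemma reduced_snoc_bar:
  assumes "reduced m" "\<not> ends_code_bar (m @ [Inr v])"
  shows "reduced (m @ [Inr v])"
proof (intro reduced_snoc assms)
  show "\<not> ends_bar_code (m @ [Inr v])"
  proof
    assume "ends_bar_code (m @ [Inr v])"
    then obtain m' v' where "v' \<in> B" "m @ [Inr v] = m' @ Inr v' # map Inl v'"
      by (auto simp: ends_bar_code_def)
    then show False
      using last_bar_unique[of m v "[]" m' v' v'] code_nonempty by auto
  qed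
qed

lemma reduced_append_letters:
  assumes "reduced m"
    and "\<And>y z. v = y @ z \<Longrightarrow> y \<noteq> [] \<Longrightarrow> \<not> ends_bar_code (m @ map Inl y)"
  shows "reduced (m @ map Inl v)"
  using assms(2)
proof (induction v rule: rev_induct)
  case Nil
  then show ?case using assms(1) by simp
next
  case (snoc c v)
  have "reduced (m @ map Inl v)"
    by (rule snoc.IH) (metis append.assoc snoc.prems)
  moreover have "\<not> ends_bar_code ((m @ map Inl v) @ [Inl c])"
    using snoc.prems[of "v @ [c]" "[]"] by simp
  ultimately show ?case using reduced_snoc_letter by fastforce
qed

text \<open>The cancelled word would end in \<open>y\<close>, a prefix of a code word, and
  overlap-freeness makes both words equal to \<open>y\<close>. So a code word being read can cancel
  only at its last letter, against its own bar.\<close>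

lemma ends_bar_code_in_code:
  assumes "y @ z \<in> B" "y \<noteq> []" "ends_bar_code (m @ map Inl y)"
  shows "z = [] \<and> (\<exists>m'. m = m' @ [Inr y])"
proof -
  obtain x m' where *: "x @ y \<in> B" "m = m' @ Inr (x @ y) # map Inl x"
    by (rule ends_bar_code_append[OF assms(3)])
  then have "x = [] \<and> z = []" using overlap_free assms(1,2) by blast
  then show ?thesis using * by simp
qed

section \<open>Mutually inverse operations on normal forms\<close>

lemma reduced_mult:
  assumes "v \<in> B" "reduced m"
  shows "reduced (code_mult v m)"
proof (cases "m \<noteq> [] \<and> last m = Inr v")
  case True
  then have "m = butlast m @ [last m]" by (metis append_butlast_last_id)
  then have "reduced (butlast m)" using assms(2) reduced_appendD by metis
  then show ?thesis using True by (simp add: code_mult_def)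
next
  case False
  have "\<not> ends_bar_code (m @ map Inl y)" if "v = y @ z" "y \<noteq> []" for y z
    using ends_bar_code_in_code[of y z m] that False assms(1) by auto
  then have "reduced (m @ map Inl v)" by (rule reduced_append_letters[OF assms(2)])
  then show ?thesis using False by (auto simp: code_mult_def)
qed

lemma reduced_divide:
  assumes "v \<in> B" "reduced m"
  shows "reduced (code_divide v m)"
proof (cases "\<exists>k. m = k @ map Inl v")
  case True
  then show ?thesis using assms(2) by (auto simp: code_divide_def dest: reduced_appendD)
next
  case False
  have "\<not> ends_code_bar (m @ [Inr v])"
    using False by (auto simp: ends_code_bar_def)
  then show ?thesis using False assms(2) reduced_snoc_bar by (simp add: code_divide_def)
qed

lemma mult_divide:
  assumes "v \<in> B" "reduced m"
  shows "code_mult v (code_divide v m) = m"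
proof (cases "\<exists>k. m = k @ map Inl v")
  case True
  then obtain k where k: "m = k @ map Inl v" by blast
  \<comment> \<open>Otherwise \<open>m\<close> would contain a bar followed by its word, and
    multiplying back would cancel instead of append.\<close>
  have "\<not> (k \<noteq> [] \<and> last k = Inr v)"
  proof
    assume "k \<noteq> [] \<and> last k = Inr v"
    then have "m = butlast k @ Inr v # map Inl v"
      using k by (metis append.assoc append_butlast_last_id append_Cons append_Nil)
    then have "ends_bar_code m" using assms(1) by (auto simp: ends_bar_code_def)
    then show False using assms(2) by (auto simp: reduced_def)
  qed
  then show ?thesis using k by (auto simp: code_mult_def code_divide_def)
next
  case False
  then show ?thesis by (simp add: code_mult_def code_divide_def)
qed

lemma divide_mult:
  assumes "v \<in> B" "reduced m"
  shows "code_divide v (code_mult v m) = m"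
proof (cases "m \<noteq> [] \<and> last m = Inr v")
  case True
  then have m: "m = butlast m @ [Inr v]" by (metis append_butlast_last_id)
  have "\<not> (\<exists>k. butlast m = k @ map Inl v)"
  proof
    assume "\<exists>k. butlast m = k @ map Inl v"
    then have "ends_code_bar m"
      using m assms(1) by (metis append.assoc ends_code_bar_def)
    then show False using assms(2) by (auto simp: reduced_def)
  qed
  then show ?thesis using True m by (simp add: code_mult_def code_divide_def)
next
  case False
  then show ?thesis by (auto simp: code_mult_def code_divide_def)
qed

definition multl :: "'a list list \<Rightarrow> ('a + 'a list) list \<Rightarrow> ('a + 'a list) list" where
  "multl vs m = fold code_mult vs m"

text \<open>\<open>foldr\<close> divides by the last factor first, since inverting a product
  reverses its factors.\<close>

definition dividel :: "'a list list \<Rightarrow> ('a + 'a list) list \<Rightarrow> ('a + 'a list) list" where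
  "dividel vs m = foldr code_divide vs m"

lemma reduced_dividel: "set vs \<subseteq> B \<Longrightarrow> reduced m \<Longrightarrow> reduced (dividel vs m)"
  by (induction vs) (auto simp: dividel_def reduced_divide)

lemma multl_dividel: "set vs \<subseteq> B \<Longrightarrow> reduced m \<Longrightarrow> multl vs (dividel vs m) = m"
proof (induction vs)
  case (Cons v vs)
  then show ?case
    using mult_divide reduced_dividel[of vs m] by (simp add: multl_def dividel_def)
qed (simp add: multl_def dividel_def)

lemma dividel_multl: "set vs \<subseteq> B \<Longrightarrow> reduced m \<Longrightarrow> dividel vs (multl vs m) = m"
proof (induction vs arbitrary: m)
  case (Cons v vs)
  then show ?case
    using divide_mult reduced_mult by (simp add: multl_def dividel_def)
qed (simp add: multl_def dividel_def)

end

section \<open>The machine acting on reduced words\<close>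

text \<open>Code words strictly inside \<open>u n\<close> are allowed: without a bar directly in
  front they cannot cancel. \<open>F n\<close> will be \<open>f n\<close> carried over to the
  states.\<close>

locale trigger_machine = overlap_free_code B for B :: "'a list set" +
  fixes u :: "nat \<Rightarrow> 'a list"
    and ps ss :: "nat \<Rightarrow> 'a list list"
    and F :: "nat \<Rightarrow> 'x \<times> ('a + 'a list) list \<Rightarrow> 'x \<times> ('a + 'a list) list"
  assumes ps: "set (ps n) \<subseteq> B" and ss: "set (ss n) \<subseteq> B"
    and u_nonempty: "u n \<noteq> []"
    and u_code: "\<lbrakk>u n = y @ z; x @ y \<in> B; y \<noteq> []\<rbrakk> \<Longrightarrow> False"
    and code_u: "\<lbrakk>y @ z \<in> B; u n = x @ y; y \<noteq> []\<rbrakk> \<Longrightarrow> False"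
    and u_not_in_code: "x @ u n @ z \<notin> B"
    and u_overlap: "\<lbrakk>u n = y @ z; u k = x @ y; y \<noteq> []\<rbrakk> \<Longrightarrow> z = []"
    and u_in_u: "u n = x @ u k @ z \<Longrightarrow> n = k"
    and F_reduced: "reduced (snd q) \<Longrightarrow> reduced (snd (F n q))"
begin

definition triggers :: "('a + 'a list) list \<Rightarrow> bool" where
  "triggers k \<longleftrightarrow> (\<exists>n h. k = h @ map Inl (u n))"

definition fire :: "nat \<Rightarrow> 'x \<times> ('a + 'a list) list \<Rightarrow> 'x \<times> ('a + 'a list) list" where
  "fire n q = map_prod id (dividel (ss n)) (F n (map_prod id (dividel (ps n)) q))"

text \<open>Completing some \<open>u n\<close> is tested before cancelling; the pair chosen by
  \<open>SOME\<close> is unique by \<open>trigger_unique\<close>.\<close>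

definition step :: "'x \<times> ('a + 'a list) list \<Rightarrow> 'a \<Rightarrow> 'x \<times> ('a + 'a list) list" where
  "step q c = (let k = snd q @ [Inl c] in
     if triggers k then
       (let (n, h) = (SOME (n, h). k = h @ map Inl (u n)) in fire n (fst q, h))
     else if ends_bar_code k then (fst q, THE m. \<exists>v\<in>B. k = m @ Inr v # map Inl v)
     else (fst q, k))"

lemma map_Inl_eq_appendD: "map Inl y = k @ map Inl x \<Longrightarrow> \<exists>z. y = z @ x"
  by (auto simp: map_eq_append_conv inj_map_eq_map)

lemma triggers_append:
  assumes "triggers (m @ map Inl y)"
  shows "\<exists>n x. u n = x @ y \<or> y = x @ u n"
proof -
  obtain n h where nh: "m @ map Inl y = h @ map Inl (u n)"
    using assms by (auto simp: triggers_def)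
  then obtain us where "m = h @ us \<and> us @ map Inl y = map Inl (u n)
      \<or> m @ us = h \<and> map Inl y = us @ map Inl (u n)"
    by (auto simp: append_eq_append_conv2)
  then show ?thesis
  proof
    assume *: "m = h @ us \<and> us @ map Inl y = map Inl (u n)"
    then show ?thesis using map_Inl_eq_appendD by metis
  next
    assume *: "m @ us = h \<and> map Inl y = us @ map Inl (u n)"
    then show ?thesis using map_Inl_eq_appendD by metis
  qed
qed

lemma trigger_unique:
  assumes "m @ map Inl (u n) = h @ map Inl (u k)"
  shows "n = k \<and> m = h"
proof -
  from assms obtain us where "m = h @ us \<and> us @ map Inl (u n) = map Inl (u k)
      \<or> m @ us = h \<and> map Inl (u n) = us @ map Inl (u k)"
    by (auto simp: append_eq_append_conv2)
  then have "n = k"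
  proof
    assume *: "m = h @ us \<and> us @ map Inl (u n) = map Inl (u k)"
    then obtain z where "u k = z @ u n @ []" using map_Inl_eq_appendD by (metis append_Nil2)
    then show ?thesis using u_in_u by blast
  next
    assume *: "m @ us = h \<and> map Inl (u n) = us @ map Inl (u k)"
    then obtain z where "u n = z @ u k @ []" using map_Inl_eq_appendD by (metis append_Nil2)
    then show ?thesis using u_in_u by blast
  qed
  then show ?thesis using assms by simp
qed

lemma step_trigger:
  assumes "m @ [Inl c] = h @ map Inl (u n)"
  shows "step (x, m) c = fire n (x, h)"
proof -
  have "(SOME (n', h'). m @ [Inl c] = h' @ map Inl (u n')) = (n, h)"
    by (rule some_equality) (use assms trigger_unique[of h n] in auto)
  moreover have "triggers (m @ [Inl c])" using assms by (auto simp: triggers_def)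
  ultimately show ?thesis by (simp add: step_def)
qed

lemma step_cancel:
  assumes "\<not> triggers (m @ [Inl c])" "v \<in> B" "m @ [Inl c] = k @ Inr v # map Inl v"
  shows "step (x, m) c = (x, k)"
proof -
  have "(THE k. \<exists>v\<in>B. m @ [Inl c] = k @ Inr v # map Inl v) = k"
    by (rule the_equality) (use assms last_bar_unique in \<open>metis+\<close>)
  moreover have "ends_bar_code (m @ [Inl c])" using assms by (auto simp: ends_bar_code_def)
  ultimately show ?thesis using assms(1) by (simp add: step_def)
qed

section \<open>Runs on code words, on \<open>u n\<close> and on \<open>w n\<close>\<close>

lemma run_literal:
  assumes "\<And>y z. v = y @ z \<Longrightarrow> y \<noteq> [] \<Longrightarrow>
      \<not> ends_bar_code (m @ map Inl y) \<and> \<not> triggers (m @ map Inl y)"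
  shows "foldl step (x, m) v = (x, m @ map Inl v)"
  using assms
proof (induction v rule: rev_induct)
  case (snoc c v)
  have "foldl step (x, m) v = (x, m @ map Inl v)"
    by (rule snoc.IH) (metis append.assoc snoc.prems)
  moreover have "\<not> ends_bar_code (m @ map Inl v @ [Inl c]) \<and> \<not> triggers (m @ map Inl v @ [Inl c])"
    using snoc.prems[of "v @ [c]" "[]"] by simp
  moreover from this have "step (x, m @ map Inl v) c = (x, m @ map Inl v @ [Inl c])"
    by (simp add: step_def)
  ultimately show ?case by simp
qed simp

lemma no_trigger_in_code:
  assumes "y @ z \<in> B" "y \<noteq> []"
  shows "\<not> triggers (m @ map Inl y)"
proof
  assume "triggers (m @ map Inl y)"
  then obtain n x where "u n = x @ y \<or> y = x @ u n" using triggers_append by blast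
  then show False
    using assms code_u u_not_in_code[of x n z] by auto
qed

lemma run_code:
  assumes "v \<in> B"
  shows "foldl step (x, m) v = (x, code_mult v m)"
proof (cases "m \<noteq> [] \<and> last m = Inr v")
  case False
  have "foldl step (x, m) v = (x, m @ map Inl v)"
  proof (rule run_literal)
    fix y z assume "v = y @ z" "y \<noteq> []"
    then show "\<not> ends_bar_code (m @ map Inl y) \<and> \<not> triggers (m @ map Inl y)"
      using ends_bar_code_in_code[of y z m] no_trigger_in_code[of y z m] assms False by auto
  qed
  then show ?thesis using False by (auto simp: code_mult_def)
next
  case True
  then have m: "m = butlast m @ [Inr v]" by (metis append_butlast_last_id)
  \<comment> \<open>The bar of \<open>v\<close> can cancel only once all of \<open>v\<close> is
    read, so the letters before the last one are appended literally.\<close>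
  obtain v' c where v: "v = v' @ [c]" using code_nonempty[OF assms] by (cases v rule: rev_cases) auto
  have "foldl step (x, m) v' = (x, m @ map Inl v')"
  proof (rule run_literal)
    fix y z assume "v' = y @ z" "y \<noteq> []"
    then show "\<not> ends_bar_code (m @ map Inl y) \<and> \<not> triggers (m @ map Inl y)"
      using ends_bar_code_in_code[of y "z @ [c]" m] no_trigger_in_code[of y "z @ [c]" m] assms v
      by auto
  qed
  moreover have "step (x, m @ map Inl v') c = (x, butlast m)"
  proof (rule step_cancel[OF _ assms])
    show "\<not> triggers ((m @ map Inl v') @ [Inl c])"
      using no_trigger_in_code[of v "[]" m] assms v by simp
    show "(m @ map Inl v') @ [Inl c] = butlast m @ Inr v # map Inl v"
      using m v by (metis append.assoc append_Cons append_Nil list.simps(8,9) map_append)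
  qed
  ultimately show ?thesis using True v by (simp add: code_mult_def)
qed

lemma run_concat_code:
  "set vs \<subseteq> B \<Longrightarrow> foldl step (x, m) (concat vs) = (x, multl vs m)"
  by (induction vs arbitrary: m) (auto simp: run_code multl_def)

text \<open>An earlier cancellation would make a prefix of \<open>u n\<close> a suffix of a code
  word; an earlier trigger would make \<open>u n\<close> overlap some \<open>u k\<close> or contain
  it properly. So the first event comes at the last letter.\<close>

lemma run_u: "foldl step (x, m) (u n) = fire n (x, m)"
proof -
  obtain v c where v: "u n = v @ [c]" using u_nonempty by (cases "u n" rule: rev_cases) auto
  have "foldl step (x, m) v = (x, m @ map Inl v)"
  proof (rule run_literal)
    fix y z assume y: "v = y @ z" "y \<noteq> []"
    then have un: "u n = y @ (z @ [c])" using v by simp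
    have "\<not> ends_bar_code (m @ map Inl y)"
      using ends_bar_code_append u_code[OF un _ y(2)] by metis
    moreover have "\<not> triggers (m @ map Inl y)"
    proof
      assume "triggers (m @ map Inl y)"
      then obtain k x where "u k = x @ y \<or> y = x @ u k" using triggers_append by blast
      then show False
      proof
        assume "u k = x @ y"
        then show False using u_overlap[OF un _ y(2)] by simp
      next
        assume yk: "y = x @ u k"
        then have "n = k" using un u_in_u[of n x k "z @ [c]"] by simp
        then show False using yk un by simp
      qed
    qed
    ultimately show "\<not> ends_bar_code (m @ map Inl y) \<and> \<not> triggers (m @ map Inl y)" by blast
  qed
  moreover have "step (x, m @ map Inl v) c = fire n (x, m)"
    by (rule step_trigger) (simp add: v)
  ultimately show ?thesis by (simp add: v)
qed

text \<open>\<open>dividel_multl\<close> cancels the factor read before \<open>u n\<close>, so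
  \<open>F n\<close> sees the original state; \<open>multl_dividel\<close> removes the correction
  made after it.\<close>

lemma run_w:
  assumes "reduced (snd q)"
  shows "foldl step q (concat (ps n) @ u n @ concat (ss n)) = F n q"
proof -
  obtain x m where q: "q = (x, m)" by (cases q)
  obtain x' m' where F: "F n (x, m) = (x', m')" by (cases "F n (x, m)")
  have "reduced m'" using F_reduced[of q n] assms q F by simp
  then show ?thesis
    using assms ps[of n] ss[of n]
    by (simp add: q run_concat_code run_u fire_def dividel_multl F multl_dividel)
qed

lemma reduced_step:
  assumes "reduced (snd q)"
  shows "reduced (snd (step q c))"
proof -
  obtain x m where q: "q = (x, m)" by (cases q)
  consider (trigger) n h where "m @ [Inl c] = h @ map Inl (u n)"
    | (cancel) k v where "\<not> triggers (m @ [Inl c])" "v \<in> B" "m @ [Inl c] = k @ Inr v # map Inl v"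
    | (literal) "\<not> triggers (m @ [Inl c])" "\<not> ends_bar_code (m @ [Inl c])"
    unfolding triggers_def ends_bar_code_def by blast
  then show ?thesis
  proof cases
    case trigger
    \<comment> \<open>As \<open>u n\<close> is nonempty, it contains the letter just read, so
      \<open>h\<close> is a prefix of \<open>m\<close>.\<close>
    obtain v d where v: "u n = v @ [d]" using u_nonempty by (cases "u n" rule: rev_cases) auto
    have "reduced h" using trigger v assms q by (auto dest: reduced_appendD)
    then have "reduced (snd (fire n (x, h)))"
      using F_reduced ps ss by (simp add: fire_def reduced_dividel)
    then show ?thesis using step_trigger[OF trigger] q by simp
  next
    case cancel
    obtain v' d where v: "v = v' @ [d]"
      using code_nonempty[OF cancel(2)] by (cases v rule: rev_cases) auto
    then have "m = k @ Inr v # map Inl v'" using cancel(3) by simp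
    then have "reduced k" using assms q by (auto dest: reduced_appendD)
    then show ?thesis using step_cancel[OF cancel] q by simp
  next
    case literal
    then show ?thesis using reduced_snoc_letter assms q by (simp add: step_def)
  qed
qed

lemma reduced_run: "reduced (snd q) \<Longrightarrow> reduced (snd (foldl step q v))"
  by (induction v arbitrary: q) (auto simp: reduced_step)

end

text \<open>Makes the words over \<open>letter + word\<close>, hence the normal forms,
  countable.\<close>

instance letter :: countable
  by countable_datatype

section \<open>Atoms of the submonoid\<close>

lemma append_eq_longerE:
  assumes "x @ t = t' @ y" "length t' \<le> length x"
  obtains r where "x = t' @ r" "r @ t = y"
proof -
  consider r where "x = t' @ r" "r @ t = y" | r where "x @ r = t'" "t = r @ y"
    using assms(1) append_eq_append_conv2[of x t t' y] by blast
  then show thesis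
  proof cases
    case 2
    then show thesis using assms(2) that[of "[]"] by auto
  qed (rule that)
qed

locale decomposed_words =
  fixes w p s u :: "nat \<Rightarrow> word"
  assumes no_overlap: "\<And>n x t y. w n = x @ t @ y \<Longrightarrow> x @ t \<in> S_w w \<Longrightarrow> t @ y \<in> S_w w \<Longrightarrow> False"
    and pref: "\<And>n. is_longest_prefix_in (S_w w) (w n) (p n)"
    and suff: "\<And>n. is_longest_suffix_in (S_w w) (w n) (s n)"
    and decomp: "\<And>n. w n = p n @ u n @ s n"
    and sub_w: "\<And>n m. subword (u n) (w m) \<longleftrightarrow> n = m"
    and sub_p: "\<And>n. \<not> subword (u n) (p n)"
begin

abbreviation S :: "word set" where "S \<equiv> S_w w"

lemma Nil_in_S: "[] \<in> S"
  by (auto simp: S_w_def submonoid_def)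

lemma append_in_S: "x \<in> S \<Longrightarrow> y \<in> S \<Longrightarrow> x @ y \<in> S"
  by (auto simp: S_w_def submonoid_def)

lemma C1:
  assumes "w n = x @ v @ t @ v @ y" "x \<in> S" "y \<in> S"
  shows "v \<in> S"
  unfolding S_w_def
proof (rule InterI)
  fix T assume T: "T \<in> {S. submonoid S \<and> cond_C1 w S \<and> cond_C2 w S}"
  then have "x \<in> T" "y \<in> T" using assms(2,3) by (auto simp: S_w_def)
  moreover have "cond_C1 w T" using T by simp
  ultimately show "v \<in> T" using assms(1) unfolding cond_C1_def by metis
qed

lemma C2:
  assumes "m \<noteq> n" "w m = x @ v @ t" "w n = t' @ v @ y" "x \<in> S" "y \<in> S"
  shows "v \<in> S"
  unfolding S_w_def
proof (rule InterI)
  fix T assume T: "T \<in> {S. submonoid S \<and> cond_C1 w S \<and> cond_C2 w S}"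
  then have "x \<in> T" "y \<in> T" using assms(4,5) by (auto simp: S_w_def)
  moreover have "cond_C2 w T" using T by simp
  ultimately show "v \<in> T" using assms(1-3) unfolding cond_C2_def by metis
qed

text \<open>(C2) covers distinct indices. For equal ones the length bound puts the occurrence after
  \<open>x\<close> to the left of the one before \<open>y\<close>, so (C1) applies with the gap
  between them.\<close>

lemma common_factor_in_S:
  assumes "w m = x @ v @ t" "w n = t' @ v @ y" "x \<in> S" "y \<in> S"
    and "m = n \<Longrightarrow> length x + length v \<le> length t'"
  shows "v \<in> S"
proof (cases "m = n")
  case False
  then show ?thesis using C2 assms by blast
next
  case True
  have "t' @ v @ y = (x @ v) @ t" using assms(1,2) True by simp
  moreover have "length (x @ v) \<le> length t'" using assms(5)[OF True] by simp
  ultimately obtain r where "t' = (x @ v) @ r" by (rule append_eq_longerE)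
  then show ?thesis using C1[of n x v r y] assms(2,3,4) by simp
qed

text \<open>The common part of a longer prefix and suffix, possibly empty, would be a
  \<open>t\<close> excluded by \<open>no_overlap\<close>; hence the strict inequality.\<close>

lemma disjoint_S:
  assumes "w n = x @ t" "w n = t' @ y" "x \<in> S" "y \<in> S"
  shows "length x < length t'"
proof (rule ccontr)
  assume "\<not> length x < length t'"
  then have "length t' \<le> length x" by simp
  moreover have "x @ t = t' @ y" using assms by simp
  ultimately obtain r where "x = t' @ r" "r @ t = y" by (metis append_eq_longerE)
  then show False using no_overlap[of n t' r t] assms by simp
qed

lemma p_in_S: "p n \<in> S" and s_in_S: "s n \<in> S"
  using pref suff by (auto simp: is_longest_prefix_in_def is_longest_suffix_in_def)

lemma prefix_le: "w n = x @ t \<Longrightarrow> x \<in> S \<Longrightarrow> length x \<le> length (p n)"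
  using pref[of n] by (auto simp: is_longest_prefix_in_def)

lemma suffix_le: "w n = t @ x \<Longrightarrow> x \<in> S \<Longrightarrow> length x \<le> length (s n)"
  using suff[of n] by (auto simp: is_longest_suffix_in_def)

lemma u_not_Nil: "u n \<noteq> []"
  using no_overlap[of n "p n" "[]" "s n"] decomp[of n] p_in_S s_in_S by auto

text \<open>Otherwise \<open>p n @ y\<close> would be a longer prefix in \<open>S\<close>.\<close>

lemma u_prefix_notin_S:
  assumes "u n = y @ z" "y \<noteq> []"
  shows "y \<notin> S"
proof
  assume "y \<in> S"
  moreover have "w n = (p n @ y) @ z @ s n" using decomp[of n] assms(1) by simp
  ultimately have "length (p n @ y) \<le> length (p n)"
    using prefix_le append_in_S[OF p_in_S] by blast
  then show False using assms(2) by simp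
qed

lemma u_suffix_notin_S:
  assumes "u n = z @ y" "y \<noteq> []"
  shows "y \<notin> S"
proof
  assume "y \<in> S"
  moreover have "w n = (p n @ z) @ y @ s n" using decomp[of n] assms(1) by simp
  ultimately have "length (y @ s n) \<le> length (s n)"
    using suffix_le append_in_S[OF _ s_in_S] by blast
  then show False using assms(2) by simp
qed

text \<open>Captures what (C1) and (C2) yield: one occurrence after an \<open>S\<close>-prefix and
  one, possibly in another word, before an \<open>S\<close>-suffix. The overlap arguments run on
  these two witnesses.\<close>

definition placed :: "word \<Rightarrow> bool" where
  "placed v \<longleftrightarrow> v \<in> S \<and> (\<exists>m x t. x \<in> S \<and> w m = x @ v @ t) \<and> (\<exists>n t y. y \<in> S \<and> w n = t @ v @ y)"

definition atoms :: "word set" where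
  "atoms = {v. placed v \<and> v \<noteq> [] \<and> \<not> (\<exists>x y. v = x @ y \<and> x \<noteq> [] \<and> y \<noteq> [] \<and> x \<in> S \<and> y \<in> S)}"

lemma placed_appendD:
  assumes "placed (x @ y)" "x \<in> S" "y \<in> S"
  shows "placed x \<and> placed y"
proof -
  obtain m x' t n t' y' where *: "x' \<in> S" "w m = x' @ (x @ y) @ t" "y' \<in> S" "w n = t' @ (x @ y) @ y'"
    using assms(1) by (auto simp: placed_def)
  have "placed x"
    unfolding placed_def
    using assms * append_in_S[of y y'] by (metis append.assoc)
  moreover have "placed y"
    unfolding placed_def
    using assms * append_in_S[of x' x] by (metis append.assoc)
  ultimately show ?thesis ..
qed

lemma placed_concat_atoms:
  "placed v \<Longrightarrow> \<exists>vs. set vs \<subseteq> atoms \<and> v = concat vs"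
proof (induction v rule: length_induct)
  case (1 v)
  show ?case
  proof (cases "v = [] \<or> v \<in> atoms")
    case True
    then show ?thesis
    proof
      assume "v = []"
      then show ?thesis by (intro exI[of _ "[]"]) simp
    next
      assume "v \<in> atoms"
      then show ?thesis by (intro exI[of _ "[v]"]) simp
    qed
  next
    case False
    then obtain x y where xy: "v = x @ y" "x \<noteq> []" "y \<noteq> []" "x \<in> S" "y \<in> S"
      using "1.prems" by (auto simp: atoms_def)
    have "placed x \<and> placed y"
      using placed_appendD[of x y] "1.prems" unfolding xy(1) using xy(4,5) by blast
    moreover have "length x < length v" "length y < length v" using xy(1-3) by simp_all
    ultimately obtain vs vs' where "set vs \<subseteq> atoms" "x = concat vs" "set vs' \<subseteq> atoms" "y = concat vs'"
      using "1.IH" by meson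
    then show ?thesis using xy(1) by (intro exI[of _ "vs @ vs'"]) auto
  qed
qed

text \<open>The products of atoms form a submonoid satisfying (C1) and (C2), so minimality puts
  \<open>S\<close> inside it.\<close>

lemma S_concat_atoms:
  assumes "v \<in> S"
  shows "\<exists>vs. set vs \<subseteq> atoms \<and> v = concat vs"
proof -
  define T where "T = concat ` lists atoms"
  have T: "v \<in> T \<longleftrightarrow> (\<exists>vs. set vs \<subseteq> atoms \<and> v = concat vs)" for v
    by (auto simp: T_def lists_eq_set)
  have concat_S: "set vs \<subseteq> atoms \<Longrightarrow> concat vs \<in> S" for vs
    by (induction vs) (auto simp: Nil_in_S append_in_S atoms_def placed_def)
  then have TS: "v \<in> T \<Longrightarrow> v \<in> S" for v by (auto simp: T)
  have "submonoid T"
    unfolding submonoid_def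
  proof (intro conjI ballI)
    show "[] \<in> T" by (auto simp: T intro: exI[of _ "[]"])
    fix x y assume "x \<in> T" "y \<in> T"
    then obtain vs vs' where "set vs \<subseteq> atoms" "x = concat vs" "set vs' \<subseteq> atoms" "y = concat vs'"
      by (auto simp: T)
    then show "x @ y \<in> T" unfolding T by (intro exI[of _ "vs @ vs'"]) auto
  qed
  moreover have "cond_C1 w T"
    unfolding cond_C1_def
  proof (intro allI impI)
    fix n x y t v assume *: "w n = x @ v @ t @ v @ y \<and> x \<in> T \<and> y \<in> T"
    then have "v \<in> S" using C1 TS by blast
    \<comment> \<open>The two occurrences of \<open>v\<close> in \<open>w n\<close> are the two
      witnesses.\<close>
    then have "placed v" unfolding placed_def using * TS by (metis append.assoc)
    then show "v \<in> T" using placed_concat_atoms T by blast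
  qed
  moreover have "cond_C2 w T"
    unfolding cond_C2_def
  proof (intro allI impI)
    fix m n x y t t' v assume *: "m \<noteq> n \<and> w m = x @ v @ t \<and> w n = t' @ v @ y \<and> x \<in> T \<and> y \<in> T"
    then have "v \<in> S" using C2 TS by blast
    then have "placed v" unfolding placed_def using * TS by metis
    then show "v \<in> T" using placed_concat_atoms T by blast
  qed
  ultimately have "S \<subseteq> T" by (auto simp: S_w_def)
  then show ?thesis using assms T by blast
qed

text \<open>The overlap \<open>y\<close> occurs right after an \<open>S\<close>-prefix
  \<open>x'\<close> and right before an \<open>S\<close>-suffix \<open>y'\<close>, as
  \<open>common_factor_in_S\<close> requires.\<close>

lemma placed_overlap:
  assumes "placed (y @ z)" "placed (x @ y)"
  shows "y \<in> S"
proof -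
  obtain m x' t where m: "x' \<in> S" "w m = x' @ (y @ z) @ t" using assms by (auto simp: placed_def)
  obtain n t' y' where n: "y' \<in> S" "w n = t' @ (x @ y) @ y'" using assms by (auto simp: placed_def)
  have S: "y @ z \<in> S" "x @ y \<in> S" using assms by (auto simp: placed_def)
  show ?thesis
  proof (rule common_factor_in_S[of m x' y "z @ t" n "t' @ x" y'])
    \<comment> \<open>Within one word, \<open>disjoint_S\<close> separates the
      \<open>S\<close>-prefix ending in \<open>y @ z\<close> from the \<open>S\<close>-suffix
      starting with \<open>x @ y\<close>, and so the two copies of \<open>y\<close>.\<close>
    assume "m = n"
    then have "length (x' @ y @ z) < length t'"
      using disjoint_S[of n "x' @ y @ z" t t' "(x @ y) @ y'"]
        m n append_in_S[OF m(1) S(1)] append_in_S[OF S(2) n(1)] by simp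
    then show "length x' + length y \<le> length (t' @ x)" by simp
  qed (use m n in auto)
qed

text \<open>With \<open>x\<close> in \<open>S\<close>, the \<open>S\<close>-prefix
  \<open>x' @ x\<close> precedes \<open>y\<close>; with \<open>y\<close> in \<open>S\<close>, the
  \<open>S\<close>-suffix \<open>y @ y'\<close> follows \<open>x\<close>. The other factor is then a
  common factor again.\<close>

lemma placed_divide:
  assumes "placed (x @ y)"
  shows "x \<in> S \<Longrightarrow> y \<in> S" and "y \<in> S \<Longrightarrow> x \<in> S"
proof -
  obtain m x' t where m: "x' \<in> S" "w m = x' @ (x @ y) @ t" using assms by (auto simp: placed_def)
  obtain n t' y' where n: "y' \<in> S" "w n = t' @ (x @ y) @ y'" using assms by (auto simp: placed_def)
  have S: "x @ y \<in> S" using assms by (auto simp: placed_def)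
  have len: "length x' + length x + length y < length t'" if "m = n"
    using disjoint_S[of n "x' @ x @ y" t t' "(x @ y) @ y'"]
      m n append_in_S[OF m(1) S] append_in_S[OF S n(1)] that by simp
  show "y \<in> S" if "x \<in> S"
    by (rule common_factor_in_S[of m "x' @ x" y t n "t' @ x" y'])
      (use m n that append_in_S len in auto)
  show "x \<in> S" if "y \<in> S"
    by (rule common_factor_in_S[of m x' x "y @ t" n t' "y @ y'"])
      (use m n that append_in_S len in auto)
qed

text \<open>The overlap lies in \<open>S\<close>, hence so do the leftovers \<open>x\<close> and
  \<open>z\<close>, and indecomposability makes them empty.\<close>

lemma atoms_overlap_free:
  assumes "y @ z \<in> atoms" "x @ y \<in> atoms" "y \<noteq> []"
  shows "x = [] \<and> z = []"
proof -
  have pl: "placed (y @ z)" "placed (x @ y)" using assms by (auto simp: atoms_def)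
  have y: "y \<in> S" using placed_overlap pl by blast
  then have "z \<in> S" "x \<in> S" using placed_divide pl by blast+
  then show ?thesis using assms y by (auto simp: atoms_def)
qed

text \<open>\<open>y\<close> follows \<open>p n\<close> in \<open>w n\<close> and precedes an
  \<open>S\<close>-suffix of some \<open>w m\<close>, so it lies in \<open>S\<close>, against the
  maximality of \<open>p n\<close>.\<close>

lemma u_prefix_placed_suffix:
  assumes "u n = y @ z" "placed (x @ y)" "y \<noteq> []"
  shows False
proof -
  obtain m t' y' where m: "y' \<in> S" "w m = t' @ (x @ y) @ y'" using assms by (auto simp: placed_def)
  have S: "x @ y \<in> S" using assms by (auto simp: placed_def)
  have "y \<in> S"
  proof (rule common_factor_in_S[of n "p n" y "z @ s n" m "t' @ x" y'])
    \<comment> \<open>Within one word, the \<open>S\<close>-suffix starting with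
      \<open>x @ y\<close> fits inside \<open>s n\<close>, hence to the right of
      \<open>u n\<close>.\<close>
    assume "n = m"
    moreover have "length (x @ y @ y') \<le> length (s m)"
      using suffix_le[of m t' "(x @ y) @ y'"] m append_in_S[OF S m(1)] by simp
    ultimately show "length (p n) + length y \<le> length (t' @ x)"
      using arg_cong[OF decomp[of n], of length] arg_cong[OF m(2), of length] assms(1) by simp
  qed (use m assms decomp p_in_S in auto)
  then show False using u_prefix_notin_S assms by blast
qed

lemma u_suffix_placed_prefix:
  assumes "placed (y @ z)" "u n = x @ y" "y \<noteq> []"
  shows False
proof -
  obtain m x' t where m: "x' \<in> S" "w m = x' @ (y @ z) @ t" using assms by (auto simp: placed_def)
  have S: "y @ z \<in> S" using assms by (auto simp: placed_def)
  have "y \<in> S"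
  proof (rule common_factor_in_S[of m x' y "z @ t" n "p n @ x" "s n"])
    assume "m = n"
    moreover have "length (x' @ y @ z) \<le> length (p m)"
      using prefix_le[of m "x' @ y @ z" t] m append_in_S[OF m(1) S] by simp
    ultimately show "length x' + length y \<le> length (p n @ x)" by simp
  qed (use m assms decomp s_in_S in auto)
  then show False using u_suffix_notin_S assms by blast
qed

text \<open>An occurrence in \<open>w m\<close> forces \<open>n = m\<close>; the
  \<open>S\<close>-prefix ending with the placed word then fits inside \<open>p n\<close>,
  contradicting \<open>sub_p\<close>.\<close>

lemma u_not_in_placed:
  assumes "placed (x @ u n @ z)"
  shows False
proof -
  obtain m x' t where m: "x' \<in> S" "w m = x' @ (x @ u n @ z) @ t" using assms by (auto simp: placed_def)
  have S: "x @ u n @ z \<in> S" using assms by (auto simp: placed_def)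
  have "subword (u n) (w m)" unfolding subword_def using m by (metis append.assoc)
  then have "n = m" using sub_w by simp
  have le: "length (x' @ x @ u n @ z) \<le> length (p n)"
    using \<open>n = m\<close> prefix_le[of m "x' @ x @ u n @ z" t] m append_in_S[OF m(1) S] by simp
  have "p n @ (u n @ s n) = (x' @ x @ u n @ z) @ t"
    using m(2) decomp[of n] \<open>n = m\<close> by simp
  then obtain r where "p n = (x' @ x @ u n @ z) @ r"
    using le by (rule append_eq_longerE)
  then have "subword (u n) (p n)" unfolding subword_def by (metis append.assoc)
  then show False using sub_p by simp
qed

text \<open>A shortest proper border occupies at most half of the word, so (C1) applies to it.\<close>

lemma u_unbordered:
  "u n = y @ z \<Longrightarrow> u n = x @ y \<Longrightarrow> y \<noteq> [] \<Longrightarrow> z = []"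
proof (induction y arbitrary: x z rule: length_induct)
  case (1 y)
  show ?case
  proof (rule ccontr)
    assume "z \<noteq> []"
    have eq: "y @ z = x @ y" using "1.prems" by simp
    show False
    proof (cases "length y \<le> length x")
      case True
      have "w n = p n @ y @ (z @ s n)" using decomp[of n] unfolding "1.prems"(1) by simp
      moreover have "w n = (p n @ x) @ y @ s n" using decomp[of n] unfolding "1.prems"(2) by simp
      ultimately have "y \<in> S"
        by (rule common_factor_in_S[OF _ _ p_in_S s_in_S]) (use True in simp)
      then show False using u_prefix_notin_S "1.prems" by blast
    next
      case False
      \<comment> \<open>The two copies of \<open>y\<close> overlap in a shorter border
        \<open>r\<close>, to which the induction hypothesis applies.\<close>
      then have "length x \<le> length y" by simp
      with eq obtain r where r: "y = x @ r" "r @ z = y" by (rule append_eq_longerE)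
      have "length x = length z" using arg_cong[OF eq, of length] by simp
      then have "r \<noteq> []" "length r < length y" using r False \<open>z \<noteq> []\<close> by auto
      moreover have "u n = r @ (z @ z)" using "1.prems"(1) r(2) by (metis append.assoc)
      moreover have "u n = (x @ x) @ r" using "1.prems"(2) r(1) by simp
      ultimately have "z @ z = []" using "1.IH" by blast
      then show False using \<open>z \<noteq> []\<close> by simp
    qed
  qed
qed

lemma u_overlap_free:
  assumes "u n = y @ z" "u k = x @ y" "y \<noteq> []"
  shows "z = []"
proof (cases "n = k")
  case True
  then show ?thesis using u_unbordered assms by blast
next
  case False
  have "y \<in> S"
    by (rule common_factor_in_S[of n "p n" y "z @ s n" k "p k @ x" "s k"])
      (use False decomp p_in_S s_in_S assms in auto)
  then show ?thesis using u_prefix_notin_S assms by blast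
qed

lemma universal:
  assumes X_inf: "infinite (UNIV :: 'x set)"
  shows "universal_for_transf w TYPE('x)"
  unfolding universal_for_transf_def
proof
  fix f :: "nat \<Rightarrow> 'x \<Rightarrow> 'x"
  include cardinal_syntax
  interpret overlap_free_code atoms
  proof unfold_locales
    show "v \<in> atoms \<Longrightarrow> v \<noteq> []" for v by (simp add: atoms_def)
  qed (rule atoms_overlap_free)
  have "\<exists>vs. set vs \<subseteq> atoms \<and> p n = concat vs" for n using S_concat_atoms p_in_S by blast
  then obtain ps where p_code: "\<And>n. set (ps n) \<subseteq> atoms \<and> p n = concat (ps n)" by metis
  have "\<exists>vs. set vs \<subseteq> atoms \<and> s n = concat vs" for n using S_concat_atoms s_in_S by blast
  then obtain ss where s_code: "\<And>n. set (ss n) \<subseteq> atoms \<and> s n = concat (ss n)" by metis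
  \<comment> \<open>The normal forms are countable, so the infinite type absorbs them as a
    factor.\<close>
  have "inj_on to_nat (Collect reduced)" by (rule inj_on_subset[OF inj_to_nat]) simp
  then have "|Collect reduced| \<le>o |UNIV :: nat set|"
    using card_of_ordLeq[of "Collect reduced" "UNIV :: nat set"] by blast
  also have "|UNIV :: nat set| \<le>o |UNIV :: 'x set|" using X_inf infinite_iff_card_of_nat by blast
  finally have le: "|Collect reduced| \<le>o |UNIV :: 'x set|" .
  have "Collect reduced \<noteq> {}" using reduced_Nil by blast
  then have "|(UNIV :: 'x set) \<times> Collect reduced| =o |UNIV :: 'x set|"
    by (rule conjunct1[OF card_of_Times_infinite[OF X_inf _ le]])
  then have "\<exists>e. bij_betw e (UNIV :: 'x set) ((UNIV :: 'x set) \<times> Collect reduced)"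
    by (rule iffD2[OF card_of_ordIso ordIso_symmetric])
  then obtain e where e: "bij_betw e (UNIV :: 'x set) ((UNIV :: 'x set) \<times> Collect reduced)" ..
  define d where "d = inv_into UNIV e"
  have de: "d (e x) = x" for x using bij_betw_inv_into_left[OF e] by (simp add: d_def)
  have ed: "reduced (snd q) \<Longrightarrow> e (d q) = q" for q
    using bij_betw_inv_into_right[OF e, of q] by (cases q) (simp add: d_def)
  have e_red: "reduced (snd (e x))" for x using bij_betwE[OF e] by (auto simp: mem_Times_iff)
  \<comment> \<open>\<open>F n\<close> is \<open>f n\<close> transported along \<open>e\<close>; its
    values are reduced because \<open>e\<close> takes only reduced states as values.\<close>
  interpret trigger_machine atoms u ps ss "\<lambda>n q. e (f n (d q))"
  proof unfold_locales
    fix n k x y z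
    show "set (ps n) \<subseteq> atoms" "set (ss n) \<subseteq> atoms" using p_code s_code by auto
    show "u n \<noteq> []" by (rule u_not_Nil)
    show "u n = y @ z \<Longrightarrow> x @ y \<in> atoms \<Longrightarrow> y \<noteq> [] \<Longrightarrow> False"
      using u_prefix_placed_suffix unfolding atoms_def by blast
    show "y @ z \<in> atoms \<Longrightarrow> u n = x @ y \<Longrightarrow> y \<noteq> [] \<Longrightarrow> False"
      using u_suffix_placed_prefix unfolding atoms_def by blast
    show "x @ u n @ z \<notin> atoms" using u_not_in_placed unfolding atoms_def by blast
    show "u n = y @ z \<Longrightarrow> u k = x @ y \<Longrightarrow> y \<noteq> [] \<Longrightarrow> z = []" by (rule u_overlap_free)
    show "n = k" if "u n = x @ u k @ z"
    proof -
      have "w n = (p n @ x) @ u k @ z @ s n" using decomp[of n] that by simp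
      then have "subword (u k) (w n)" unfolding subword_def by blast
      then show ?thesis using sub_w by simp
    qed
  qed (rule e_red)
  define \<Phi> where "\<Phi> v x = d (foldl step (e x) v)" for v x
  \<comment> \<open>Runs from reduced states stay reduced, so \<open>e\<close> undoes
    \<open>d\<close> between the two halves.\<close>
  have "\<Phi> (v @ v') = \<Phi> v' \<circ> \<Phi> v" for v v'
    by (rule ext) (simp add: \<Phi>_def ed reduced_run e_red)
  moreover have "\<Phi> (w n) = f n" for n
  proof
    fix x
    have "w n = concat (ps n) @ u n @ concat (ss n)" using decomp p_code s_code by metis
    then show "\<Phi> (w n) x = f n x"
      using run_w[OF e_red[of x], of n] by (simp add: \<Phi>_def de)
  qed
  ultimately show "\<exists>\<Phi>. (\<forall>u v. u \<noteq> [] \<longrightarrow> v \<noteq> [] \<longrightarrow> \<Phi> (u @ v) = \<Phi> v \<circ> \<Phi> u) \<and> (\<forall>n. \<Phi> (w n) = f n)"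
    by blast
qed

end

theorem theorem3p2:
  fixes w p s u :: "nat \<Rightarrow> word"
  assumes nonempty: "\<forall>n. w n \<noteq> []"
    and no_overlap: "\<forall>n. \<not> (\<exists>x t y. w n = x @ t @ y \<and> x @ t \<in> S_w w \<and> t @ y \<in> S_w w)"
    and pref: "\<forall>n. is_longest_prefix_in (S_w w) (w n) (p n)"
    and suff: "\<forall>n. is_longest_suffix_in (S_w w) (w n) (s n)"
    and decomp: "\<forall>n. w n = p n @ u n @ s n"
    and sub_w: "\<forall>n m. subword (u n) (w m) \<longleftrightarrow> n = m"
    and sub_p: "\<forall>n. \<not> subword (u n) (p n)"
    and X_inf: "infinite (UNIV :: 'x set)"
  shows "universal_for_transf w TYPE('x)"
proof -
  interpret decomposed_words w p s u
    by unfold_locales (use no_overlap pref suff decomp sub_w sub_p in blast)+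
  show ?thesis using universal X_inf .
qed

end
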